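(* Let $u_n:=|\mathfrak{A}_{2n+1}(1342,2431)|$ for $n\ge0$ and $U(x):=\sum_{n\ge0}u_nx^n$. Then $$U(x)=\frac{\sqrt{1-4x}}{\sqrt{1-4x}-2x}=\cfrac{1}{1-\cfrac{2x}{1-\cfrac{2x}{1-\cfrac{x}{1-\cfrac{x}{\ddots}}}}},$$ where in the continued fraction all partial numerators after the first two equal $x$.
   Context: $\mathfrak{A}_m(1342,2431)$ is the set of permutations $\pi$ of $[m]$ that are alternating (up-down), i.e. $\pi(1)<\pi(2)>\pi(3)<\pi(4)>\cdots$, and avoid both classical patterns $1342$ and $2431$. *)

theory Defs
  imports Complex_Main
begin

definition is_perm_of :: "nat \<Rightarrow> nat list \<Rightarrow> bool" where
  "is_perm_of m xs \<longleftrightarrow> distinct xs \<and> set xs = {1..m}"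

text \<open>Up-down alternating: pi(1) < pi(2) > pi(3) < pi(4) > ... (0-based positions here).\<close>
definition alternating :: "nat list \<Rightarrow> bool" where
  "alternating xs \<longleftrightarrow>
     (\<forall>i. Suc i < length xs \<longrightarrow>
        (if even i then xs ! i < xs ! Suc i else xs ! i > xs ! Suc i))"

definition contains :: "nat list \<Rightarrow> nat list \<Rightarrow> bool" where
  "contains xs p \<longleftrightarrow>
     (\<exists>idx. length idx = length p \<and> sorted_wrt (<) idx \<and> (\<forall>j\<in>set idx. j < length xs) \<and>
        (\<forall>a<length p. \<forall>b<length p. xs ! (idx ! a) < xs ! (idx ! b) \<longleftrightarrow> p ! a < p ! b))"

definition avoids :: "nat list \<Rightarrow> nat list \<Rightarrow> bool" where
  "avoids xs p \<longleftrightarrow> \<not> contains xs p"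

definition altAvoid :: "nat \<Rightarrow> nat list set" where
  "altAvoid m = {xs. is_perm_of m xs \<and> alternating xs \<and>
                     avoids xs [1,3,4,2] \<and> avoids xs [2,4,3,1]}"

text \<open>Continued fraction convergents: cf_den a j k = 1 - a j / (1 - a (j+1) / ( ... (1 - a (j+k-1) / 1))),
  truncated after k partial numerators; the k-th convergent of
  1/(1 - a 1/(1 - a 2/(1 - ...))) is 1 / cf_den a 1 k.\<close>
fun cf_den :: "(nat \<Rightarrow> real) \<Rightarrow> nat \<Rightarrow> nat \<Rightarrow> real" where
  "cf_den a j 0 = 1"
| "cf_den a j (Suc k) = 1 - a j / cf_den a (Suc j) k"

end

theory Submission
  imports Defs "HOL-Library.Sublist"
begin

text \<open>
  Let \<open>n\<close> and \<open>m\<close> be the largest and second largest entries of an up-down permutation of odd length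
  at least 3 avoiding 1342 and 2431. Reversal exchanges the two patterns, so we may count the
  permutations in which \<open>m\<close> precedes \<open>n\<close> and double. If \<open>m\<close> comes first, it is followed by \<open>n\<close> and then
  by an arbitrary permutation of the class. Otherwise the permutation is \<open>A m P\<close> with \<open>A\<close> and \<open>P\<close> of odd
  length: every entry of \<open>A\<close> exceeds every entry of \<open>P\<close> except \<open>n\<close>, the word \<open>A\<close> is an up-down
  132-avoider, and \<open>P\<close> is in the class and has length at least 3. Up-down 132-avoiders of odd length
  are counted by the Catalan numbers \<open>c\<close>, so \<open>u (k + 1) = 2 * (u k + (\<Sum>i<k. c i * u (k - i)))\<close>, that is,
  \<open>U = 1 + 2 x (U + C (U - 1))\<close> with \<open>1 - 2 x C = sqrt (1 - 4 x)\<close>.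
\<close>

subsection \<open>Alternating words and pattern occurrences\<close>

lemma alternating_Nil [simp]: "alternating []"
  by (simp add: alternating_def)

lemma alternating_singleton [simp]: "alternating [x]"
  by (simp add: alternating_def)

lemma alternating_Cons_Cons [simp]:
  "alternating (x # y # zs) \<longleftrightarrow> x < y \<and> (zs \<noteq> [] \<longrightarrow> hd zs < y) \<and> alternating zs"
proof
  assume *: "alternating (x # y # zs)"
  have "x < y" using *[unfolded alternating_def, rule_format, of 0] by simp
  moreover have "hd zs < y" if "zs \<noteq> []"
    using *[unfolded alternating_def, rule_format, of 1] that by (simp add: hd_conv_nth)
  moreover have "alternating zs"
    unfolding alternating_def
  proof (intro allI impI)
    fix i assume "Suc i < length zs"
    then show "if even i then zs ! i < zs ! Suc i else zs ! Suc i < zs ! i"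
      using *[unfolded alternating_def, rule_format, of "Suc (Suc i)"]
      by (auto split: if_splits)
  qed
  ultimately show "x < y \<and> (zs \<noteq> [] \<longrightarrow> hd zs < y) \<and> alternating zs" by blast
next
  assume *: "x < y \<and> (zs \<noteq> [] \<longrightarrow> hd zs < y) \<and> alternating zs"
  show "alternating (x # y # zs)"
    unfolding alternating_def
  proof (intro allI impI)
    fix i assume i: "Suc i < length (x # y # zs)"
    consider "i = 0" | "i = 1" | j where "i = Suc (Suc j)"
      by (metis One_nat_def not0_implies_Suc)
    then show "if even i then (x # y # zs) ! i < (x # y # zs) ! Suc i
               else (x # y # zs) ! Suc i < (x # y # zs) ! i"
    proof cases
      case 1 then show ?thesis using * by simp
    next
      case 2 then show ?thesis using * i by (cases zs) auto
    next
      case 3 then show ?thesis using * i by (simp add: alternating_def)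
    qed
  qed
qed

text \<open>After a prefix of odd length \<open>m\<close> stands at a peak. The prefix ends in a
  valley and \<open>ys\<close> starts in one, so the condition splits into independent conditions on
  the two sides.\<close>

lemma alternating_append_Cons_odd:
  "odd (length xs) \<Longrightarrow>
   alternating (xs @ m # ys) \<longleftrightarrow>
     alternating xs \<and> last xs < m \<and> (ys \<noteq> [] \<longrightarrow> hd ys < m) \<and> alternating ys"
proof (induction xs rule: induct_list012)
  case (3 x y zs)
  then have "zs \<noteq> []" by auto
  with 3 show ?case by auto
qed auto

text \<open>After a prefix of even length \<open>m\<close> stands in a valley, so both neighbours
  exceed it. This is what excludes a large entry from such a position.\<close>

lemma alternating_append_Cons_even:
  "even (length xs) \<Longrightarrow> alternating (xs @ m # ys) \<Longrightarrow>
     (xs \<noteq> [] \<longrightarrow> m < last xs) \<and> (ys \<noteq> [] \<longrightarrow> m < hd ys)"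
proof (induction xs rule: induct_list012)
  case 1
  then show ?case by (cases ys) auto
next
  case (3 x y zs)
  then show ?case by (cases "zs = []") auto
qed auto

text \<open>In a word of odd length a position and its mirror image have the same parity, so peaks
  stay peaks.\<close>

lemma alternating_rev_odd:
  assumes "odd (length xs)" "alternating xs"
  shows "alternating (rev xs)"
  unfolding alternating_def
proof (intro allI impI)
  fix i assume i: "Suc i < length (rev xs)"
  \<comment> \<open>The pair at \<open>i\<close>, \<open>Suc i\<close> in the reversal is the pair
    at \<open>Suc j\<close>, \<open>j\<close> in \<open>xs\<close>; \<open>j\<close> and
    \<open>i\<close> have opposite parity, which matches the reversed direction of
    comparison.\<close>
  define j where "j = length xs - Suc (Suc i)"
  have j: "Suc j < length xs" "length xs - Suc i = Suc j" "even j \<longleftrightarrow> odd i"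
    using i assms(1) unfolding j_def by auto
  show "if even i then rev xs ! i < rev xs ! Suc i else rev xs ! Suc i < rev xs ! i"
    using assms(2)[unfolded alternating_def, rule_format, OF j(1)] i j
    by (auto simp: rev_nth j_def[symmetric])
qed

section \<open>Pattern occurrences as subsequences\<close>

lemma subseq_iff_map_nth:
  "subseq ys xs \<longleftrightarrow>
     (\<exists>idx. sorted_wrt (<) idx \<and> (\<forall>j\<in>set idx. j < length xs) \<and> ys = map ((!) xs) idx)"
proof
  assume "subseq ys xs"
  then show "\<exists>idx. sorted_wrt (<) idx \<and> (\<forall>j\<in>set idx. j < length xs) \<and> ys = map ((!) xs) idx"
  proof induction
    case (list_emb_Nil ys)
    show ?case by (rule exI[of _ "[]"]) simp
  next
    case (list_emb_Cons xs ys y)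
    then obtain idx where "sorted_wrt (<) idx" "\<forall>j\<in>set idx. j < length ys" "xs = map ((!) ys) idx"
      by blast
    then show ?case by (intro exI[of _ "map Suc idx"]) (auto simp: sorted_wrt_map)
  next
    case (list_emb_Cons2 x y xs ys)
    then obtain idx where "sorted_wrt (<) idx" "\<forall>j\<in>set idx. j < length ys" "xs = map ((!) ys) idx"
      by blast
    with list_emb_Cons2 show ?case by (intro exI[of _ "0 # map Suc idx"]) (auto simp: sorted_wrt_map)
  qed
next
  assume "\<exists>idx. sorted_wrt (<) idx \<and> (\<forall>j\<in>set idx. j < length xs) \<and> ys = map ((!) xs) idx"
  then obtain idx where idx: "sorted_wrt (<) idx" "\<forall>j\<in>set idx. j < length xs" "ys = map ((!) xs) idx"
    by blast
  \<comment> \<open>A strictly increasing list of valid positions is a subsequence of the list of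
    all positions; mapping \<open>(!) xs\<close> over both carries this to the words.\<close>
  then have "subseq idx [0..<length xs]"
    by (intro sorted_subset_imp_subseq) (auto simp: strict_sorted_iff)
  then have "subseq (map ((!) xs) idx) (map ((!) xs) [0..<length xs])"
    by (rule subseq_map)
  then show "subseq ys xs" using idx by (simp add: map_nth)
qed

text \<open>Replaces position tuples by the selected letters, so that occurrences can be followed
  through concatenation and reversal.\<close>

lemma contains_iff_subseq:
  "contains xs p \<longleftrightarrow>
     (\<exists>ys. subseq ys xs \<and> length ys = length p \<and>
       (\<forall>a<length p. \<forall>b<length p. ys ! a < ys ! b \<longleftrightarrow> p ! a < p ! b))"
proof
  assume "contains xs p"
  then obtain idx where idx: "length idx = length p" "sorted_wrt (<) idx" "\<forall>j\<in>set idx. j < length xs"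
    "\<forall>a<length p. \<forall>b<length p. xs ! (idx ! a) < xs ! (idx ! b) \<longleftrightarrow> p ! a < p ! b"
    unfolding contains_def by blast
  then show "\<exists>ys. subseq ys xs \<and> length ys = length p \<and>
       (\<forall>a<length p. \<forall>b<length p. ys ! a < ys ! b \<longleftrightarrow> p ! a < p ! b)"
    by (intro exI[of _ "map ((!) xs) idx"]) (auto simp: subseq_iff_map_nth)
next
  assume "\<exists>ys. subseq ys xs \<and> length ys = length p \<and>
       (\<forall>a<length p. \<forall>b<length p. ys ! a < ys ! b \<longleftrightarrow> p ! a < p ! b)"
  then obtain idx where "sorted_wrt (<) idx" "\<forall>j\<in>set idx. j < length xs" "length idx = length p"
    "\<forall>a<length p. \<forall>b<length p. map ((!) xs) idx ! a < map ((!) xs) idx ! b \<longleftrightarrow> p ! a < p ! b"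
    by (auto simp: subseq_iff_map_nth)
  then show "contains xs p"
    unfolding contains_def by (intro exI[of _ idx]) auto
qed

lemma subseq_rev: "subseq xs ys \<Longrightarrow> subseq (rev xs) (rev ys)"
  by (induction rule: list_emb.induct) (auto intro: list_emb_append_mono)

definition avoids132 :: "nat list \<Rightarrow> bool" where
  "avoids132 xs \<longleftrightarrow> (\<forall>a b c. subseq [a, b, c] xs \<longrightarrow> \<not> (a < c \<and> c < b))"

definition avoids1342 :: "nat list \<Rightarrow> bool" where
  "avoids1342 xs \<longleftrightarrow> (\<forall>a b c d. subseq [a, b, c, d] xs \<longrightarrow> \<not> (a < d \<and> d < b \<and> b < c))"

definition avoids2431 :: "nat list \<Rightarrow> bool" where
  "avoids2431 xs \<longleftrightarrow> (\<forall>a b c d. subseq [a, b, c, d] xs \<longrightarrow> \<not> (d < a \<and> a < c \<and> c < b))"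

lemma ex_length_4_iff:
  "(\<exists>ys. P ys \<and> length ys = 4 \<and> Q ys) \<longleftrightarrow> (\<exists>a b c d. P [a, b, c, d] \<and> Q [a, b, c, d])"
  by (fastforce simp: numeral_eq_Suc length_Suc_conv)

text \<open>The sixteen pairwise comparisons collapse to one chain of strict inequalities, which
  lists the letters in the order of their pattern values.\<close>

lemma avoids_1342_iff: "avoids xs [1,3,4,2] \<longleftrightarrow> avoids1342 xs"
proof -
  have order: "(\<forall>i<4. \<forall>j<4. [a,b,c,d] ! i < [a,b,c,d] ! j \<longleftrightarrow> [1,3,4,2::nat] ! i < [1,3,4,2] ! j)
      \<longleftrightarrow> a < d \<and> d < b \<and> b < c" for a b c d :: nat
    by (auto simp: numeral_eq_Suc All_less_Suc)
  have len: "length [1,3,4,2::nat] = 4" by simp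
  show ?thesis
    unfolding avoids_def contains_iff_subseq len ex_length_4_iff order avoids1342_def by blast
qed

lemma avoids_2431_iff: "avoids xs [2,4,3,1] \<longleftrightarrow> avoids2431 xs"
proof -
  have order: "(\<forall>i<4. \<forall>j<4. [a,b,c,d] ! i < [a,b,c,d] ! j \<longleftrightarrow> [2,4,3,1::nat] ! i < [2,4,3,1] ! j)
      \<longleftrightarrow> d < a \<and> a < c \<and> c < b" for a b c d :: nat
    by (auto simp: numeral_eq_Suc All_less_Suc)
  have len: "length [2,4,3,1::nat] = 4" by simp
  show ?thesis
    unfolding avoids_def contains_iff_subseq len ex_length_4_iff order avoids2431_def by blast
qed

lemma avoids132_subseq: "avoids132 xs \<Longrightarrow> subseq ys xs \<Longrightarrow> avoids132 ys"
  unfolding avoids132_def by (meson subseq_order.order_trans)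

lemma avoids1342_subseq: "avoids1342 xs \<Longrightarrow> subseq ys xs \<Longrightarrow> avoids1342 ys"
  unfolding avoids1342_def by (meson subseq_order.order_trans)

lemma avoids2431_subseq: "avoids2431 xs \<Longrightarrow> subseq ys xs \<Longrightarrow> avoids2431 ys"
  unfolding avoids2431_def by (meson subseq_order.order_trans)

lemma avoids1342_rev:
  assumes "avoids2431 xs"
  shows "avoids1342 (rev xs)"
  unfolding avoids1342_def
proof (intro allI impI)
  fix a b c d assume "subseq [a, b, c, d] (rev xs)"
  then have "subseq [d, c, b, a] xs"
    using subseq_rev by fastforce
  then show "\<not> (a < d \<and> d < b \<and> b < c)"
    using assms unfolding avoids2431_def by blast
qed

lemma avoids2431_rev:
  assumes "avoids1342 xs"
  shows "avoids2431 (rev xs)"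
  unfolding avoids2431_def
proof (intro allI impI)
  fix a b c d assume "subseq [a, b, c, d] (rev xs)"
  then have "subseq [d, c, b, a] xs"
    using subseq_rev by fastforce
  then show "\<not> (d < a \<and> a < c \<and> c < b)"
    using assms unfolding avoids1342_def by blast
qed

subsection \<open>Upper sets\<close>

text \<open>For finite \<open>S\<close> these are the sets consisting of the k largest elements of
  \<open>S\<close>. They occur as the sets of letters before the cut in the decompositions
  below.\<close>

definition upper_sets :: "nat set \<Rightarrow> nat set set" where
  "upper_sets S = {H. H \<subseteq> S \<and> (\<forall>h\<in>H. \<forall>l\<in>S - H. l < h)}"

lemma finite_upper_sets: "finite S \<Longrightarrow> finite (upper_sets S)"
  unfolding upper_sets_def by (rule finite_subset[of _ "Pow S"]) auto

text \<open>Any two upper sets are comparable by inclusion, so the size determines the set. Adding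
  the largest remaining element to an upper set reaches the next size.\<close>

lemma bij_betw_card_upper_sets:
  assumes "finite S"
  shows "bij_betw card (upper_sets S) {..card S}"
  unfolding bij_betw_def
proof
  show "inj_on card (upper_sets S)"
  proof (rule inj_onI)
    fix H K assume HK: "H \<in> upper_sets S" "K \<in> upper_sets S" "card H = card K"
    then have fin: "finite H" "finite K"
      using assms finite_subset unfolding upper_sets_def by blast+
    have "H \<subseteq> K \<or> K \<subseteq> H"
    proof (rule ccontr)
      assume "\<not> ?thesis"
      then obtain h k where "h \<in> H" "h \<notin> K" "k \<in> K" "k \<notin> H" by blast
      then have "h < k" "k < h" using HK unfolding upper_sets_def by blast+
      then show False by simp
    qed
    then show "H = K" using HK(3) fin by (metis card_subset_eq)
  qed
  have "\<exists>H\<in>upper_sets S. card H = k" if "k \<le> card S" for k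
    using that
  proof (induction k)
    case 0
    show ?case by (rule bexI[of _ "{}"]) (auto simp: upper_sets_def)
  next
    case (Suc k)
    then obtain H where H: "H \<in> upper_sets S" "card H = k" by auto
    then have HS: "H \<subseteq> S" "finite H"
      using assms finite_subset unfolding upper_sets_def by blast+
    then have ne: "S - H \<noteq> {}" using Suc.prems H(2) assms card_mono[of H S] by auto
    define x where "x = Max (S - H)"
    have x: "x \<in> S - H" "\<And>y. y \<in> S - H \<Longrightarrow> y \<le> x"
      unfolding x_def using ne assms by (auto intro: Max_in simp del: Diff_iff)
    have "insert x H \<in> upper_sets S"
      using H(1) x unfolding upper_sets_def by (auto simp: order.strict_iff_order)
    moreover have "card (insert x H) = Suc k" using x HS H by simp
    ultimately show ?case by blast
  qed
  then show "card ` upper_sets S = {..card S}"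
    using assms by (auto simp: upper_sets_def card_mono)
qed

lemma bij_betw_card_proper_upper_sets:
  assumes "finite S"
  shows "bij_betw card (upper_sets S - {S}) {..<card S}"
proof -
  have "S \<in> upper_sets S" by (simp add: upper_sets_def)
  then have "bij_betw card (upper_sets S - {S}) ({..card S} - {card S})"
    using bij_betw_DiffI[OF bij_betw_card_upper_sets[OF assms], of "{S}" "{card S}"] by simp
  moreover have "{..card S} - {card S} = {..<card S}" by auto
  ultimately show ?thesis by simp
qed

text \<open>The odd numbers up to \<open>2 * n\<close> are \<open>2 * i + 1\<close> with
  \<open>i < n\<close>. Only blocks of odd size contribute to the counts, and this turns a sum over
  sizes into a sum over \<open>i\<close>.\<close>

lemma sum_odd_lessThan:
  fixes g :: "nat \<Rightarrow> nat"
  shows "(\<Sum>k<Suc (2 * n). if odd k then g (k div 2) else 0) = (\<Sum>i<n. g i)"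
  by (induction n) auto

subsection \<open>Decomposition at the largest entries\<close>

text \<open>Arrangements of an arbitrary set \<open>S\<close> rather than of an initial segment, so
  that the blocks of a decomposition belong to such classes without relabelling. The same holds for
  \<open>alt_perms\<close>.\<close>

definition alt_perms132 :: "nat set \<Rightarrow> nat list set" where
  "alt_perms132 S = {xs. distinct xs \<and> set xs = S \<and> odd (length xs) \<and> alternating xs \<and> avoids132 xs}"

definition alt_perms :: "nat set \<Rightarrow> nat list set" where
  "alt_perms S = {xs. distinct xs \<and> set xs = S \<and> odd (length xs) \<and> alternating xs \<and>
                      avoids1342 xs \<and> avoids2431 xs}"

section \<open>Subsequences of words cut in two\<close>

lemma subseq_set_mono: "subseq xs ys \<Longrightarrow> set xs \<subseteq> set ys"
  by (induction rule: list_emb.induct) auto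

lemma subseq_pair_after:
  "m \<notin> set A \<Longrightarrow> subseq [m, n] (A @ m # B) \<longleftrightarrow> n \<in> set B"
  by (induction A) (auto simp: subseq_singleton_left)

lemma subseq_pair_before:
  "m \<notin> set B \<Longrightarrow> n \<noteq> m \<Longrightarrow> subseq [n, m] (A @ m # B) \<longleftrightarrow> n \<in> set A"
  by (induction A) (auto simp: subseq_singleton_left dest: subseq_set_mono)

text \<open>The cases go by how many of the letters fall into \<open>xs\<close>.\<close>

lemma subseq3_append:
  "subseq [a, b, c] (xs @ ys) \<Longrightarrow>
   subseq [a, b, c] ys \<or> a \<in> set xs \<and> subseq [b, c] ys \<or>
   subseq [a, b] xs \<and> c \<in> set ys \<or> subseq [a, b, c] xs"
  unfolding subseq_append_iff Cons_eq_append_conv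
  by (auto simp: subseq_singleton_left)

lemma subseq4_append:
  "subseq [a, b, c, d] (xs @ ys) \<Longrightarrow>
   subseq [a, b, c, d] ys \<or> a \<in> set xs \<and> subseq [b, c, d] ys \<or>
   subseq [a, b] xs \<and> subseq [c, d] ys \<or>
   subseq [a, b, c] xs \<and> d \<in> set ys \<or> subseq [a, b, c, d] xs"
  unfolding subseq_append_iff Cons_eq_append_conv
  by (auto simp: subseq_singleton_left)

lemma alt_perms132_even_card_empty: "even (card S) \<Longrightarrow> alt_perms132 S = {}"
  by (auto simp: alt_perms132_def distinct_card)

lemma finite_alt_perms132: "finite S \<Longrightarrow> finite (alt_perms132 S)"
  by (rule finite_subset[OF _ finite_subset_distinct[of S]]) (auto simp: alt_perms132_def)

lemma finite_alt_perms: "finite S \<Longrightarrow> finite (alt_perms S)"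
  by (rule finite_subset[OF _ finite_subset_distinct[of S]]) (auto simp: alt_perms_def)

lemma alt_perms132_singleton: "alt_perms132 {x} = {[x]}"
proof -
  have "xs = [x]" if "distinct xs" "set xs = {x}" for xs
    using that by (cases xs) (auto simp: subset_singleton_iff)
  then show ?thesis by (auto simp: alt_perms132_def avoids132_def split: if_splits)
qed

lemma alt_perms_singleton: "alt_perms {x} = {[x]}"
proof -
  have "xs = [x]" if "distinct xs" "set xs = {x}" for xs
    using that by (cases xs) (auto simp: subset_singleton_iff)
  then show ?thesis by (auto simp: alt_perms_def avoids1342_def avoids2431_def split: if_splits)
qed

section \<open>Splitting a 132-avoider at its largest entry\<close>

lemma subseq_append_Cons_middle:
  "a \<in> set A \<Longrightarrow> b \<in> set B \<Longrightarrow> subseq [a, m, b] (A @ m # B)"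
  using list_emb_append_mono[of "(=)" "[a]" A "[m, b]" "m # B"] by (simp add: subseq_singleton_left)

text \<open>The maximum \<open>m\<close> has a neighbour, hence cannot be a valley, so both sides of
  it have odd length. With \<open>m\<close> as the 3 of a 132, every letter of \<open>A\<close> must
  exceed every letter of \<open>B\<close>. Conversely, this order prevents an occurrence from
  crossing the cut.\<close>

lemma alt_perms132_insert_max:
  assumes "T \<noteq> {}" and lt: "\<And>t. t \<in> T \<Longrightarrow> t < m"
  shows "alt_perms132 (insert m T) =
    (\<lambda>(H, A, B). A @ m # B) ` (SIGMA H:upper_sets T. alt_perms132 H \<times> alt_perms132 (T - H))"
    (is "?L = ?R")
proof (intro equalityI subsetI)
  have m: "m \<notin> T" using lt by blast
  fix xs assume "xs \<in> ?L"
  then have xs: "distinct xs" "set xs = insert m T" "odd (length xs)" "alternating xs" "avoids132 xs"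
    by (auto simp: alt_perms132_def)
  then obtain A B where AB: "xs = A @ m # B" by (metis insertI1 split_list)
  have T: "set A \<union> set B = T" "set A \<inter> set B = {}" "distinct A" "distinct B"
    using xs m AB by auto
  have "odd (length A)"
  proof
    assume ev: "even (length A)"
    from alternating_append_Cons_even[OF ev xs(4)[unfolded AB]] lt T have "A = []" "B = []"
      by (metis Un_iff hd_in_set last_in_set not_less_iff_gr_or_eq)+
    then show False using T assms(1) by auto
  qed
  moreover from this have "odd (length B)" using xs(3) AB by auto
  moreover have "alternating A" "alternating B"
    using alternating_append_Cons_odd[OF \<open>odd (length A)\<close>] xs(4) AB by auto
  moreover have "avoids132 A" "avoids132 B"
    using xs(5) AB by (auto intro: avoids132_subseq)
  ultimately have "A \<in> alt_perms132 (set A)" "B \<in> alt_perms132 (T - set A)"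
    using T by (auto simp: alt_perms132_def)
  moreover have "b < a" if "a \<in> set A" "b \<in> set B" for a b
  proof -
    have "\<not> (a < b \<and> b < m)"
      using xs(5) subseq_append_Cons_middle[OF that] AB unfolding avoids132_def by blast
    moreover have "b < m" "a \<noteq> b" using lt T that by auto
    ultimately show ?thesis by auto
  qed
  then have "set A \<in> upper_sets T" using T by (auto simp: upper_sets_def)
  ultimately show "xs \<in> ?R" using AB by force
next
  have m: "m \<notin> T" using lt by blast
  fix xs assume "xs \<in> ?R"
  then obtain H A B where H: "H \<in> upper_sets T" and A: "A \<in> alt_perms132 H" and B: "B \<in> alt_perms132 (T - H)"
    and xs: "xs = A @ m # B" by auto
  have A': "distinct A" "set A = H" "odd (length A)" "alternating A" "avoids132 A"
    and B': "distinct B" "set B = T - H" "odd (length B)" "alternating B" "avoids132 B"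
    using A B by (auto simp: alt_perms132_def)
  have HT: "H \<subseteq> T" "\<And>h l. h \<in> H \<Longrightarrow> l \<in> T - H \<Longrightarrow> l < h" using H by (auto simp: upper_sets_def)
  have ne: "A \<noteq> []" "B \<noteq> []" using A' B' by auto
  then have "last A < m" "hd B < m"
    using lt A' B' HT last_in_set[of A] hd_in_set[of B] by auto
  then have "alternating xs" using alternating_append_Cons_odd A' B' xs by simp
  moreover have "avoids132 xs"
    unfolding avoids132_def
  proof (intro allI impI notI)
    fix a b c assume s: "subseq [a, b, c] xs" and o: "a < c \<and> c < b"
    from subseq3_append[OF s[unfolded xs]] show False
    proof (elim disjE conjE)
      assume s: "subseq [a, b, c] (m # B)"
      \<comment> \<open>The letter \<open>b\<close> is at most \<open>m\<close>, so
        \<open>c < m\<close> and hence \<open>a < m\<close>: the occurrence cannot start with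
        \<open>m\<close> and lies in \<open>B\<close>.\<close>
      then have "c < m" using subseq_set_mono[OF s] B' lt[of b] o by auto
      with s o have "subseq [a, b, c] B" by (auto split: if_splits)
      then show False using B'(5) o unfolding avoids132_def by blast
    next
      assume "a \<in> set A" and s: "subseq [b, c] (m # B)"
      from s have "c \<in> set B" by (auto simp: subseq_singleton_left split: if_splits dest: subseq_set_mono)
      then show False using HT(2)[of a c] \<open>a \<in> set A\<close> o A' B' by auto
    next
      assume s: "subseq [a, b] A" and c: "c \<in> set (m # B)"
      from subseq_set_mono[OF s] have "a \<in> H" "b \<in> H" using A' by auto
      then show False using HT(1) HT(2)[of a c] lt[of b] o c B' by auto
    next
      assume "subseq [a, b, c] A"
      then show False using A'(5) o unfolding avoids132_def by blast
    qed
  qed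
  ultimately show "xs \<in> ?L" using A' B' HT m xs by (auto simp: alt_perms132_def)
qed

section \<open>Counting sequences and the count of 132-avoiders\<close>

fun catalan :: "nat \<Rightarrow> nat" where
  "catalan 0 = 1"
| "catalan (Suc n) = (\<Sum>i\<le>n. catalan i * catalan (n - i))"

text \<open>The index \<open>n - i\<close> in the sum never reaches 0, because the block after
  \<open>m\<close> has length at least 3. The separate term \<open>alt_count n\<close> belongs to
  the words that start with the second largest entry.\<close>

fun alt_count :: "nat \<Rightarrow> nat" where
  "alt_count 0 = 1"
| "alt_count (Suc n) = 2 * (alt_count n + (\<Sum>i<n. catalan i * alt_count (n - i)))"

text \<open>Since \<open>m\<close> does not occur in \<open>A\<close>, its first occurrence marks
  the cut; this recovers \<open>A\<close> and \<open>B\<close>, and then \<open>H\<close> as the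
  letter set of \<open>A\<close>.\<close>

lemma inj_on_split_at:
  assumes "\<And>H A B. (H, A, B) \<in> X \<Longrightarrow> set A = H \<and> m \<notin> H"
  shows "inj_on (\<lambda>(H, A, B). A @ m # B) X"
proof (rule inj_onI)
  fix p q assume pq: "p \<in> X" "q \<in> X"
    and eq: "(\<lambda>(H, A, B). A @ m # B) p = (\<lambda>(H, A, B). A @ m # B) q"
  obtain H A B H' A' B' where p: "p = (H, A, B)" "q = (H', A', B')" by (metis prod_cases3)
  have *: "set A = H" "m \<notin> set A" "set A' = H'" "m \<notin> set A'"
    using assms[OF pq(1)[unfolded p]] assms[OF pq(2)[unfolded p]] by auto
  have "A @ m # B = A' @ m # B'" using eq p by simp
  moreover from this have "takeWhile (\<lambda>x. x \<noteq> m) (A @ m # B) = takeWhile (\<lambda>x. x \<noteq> m) (A' @ m # B')"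
    by simp
  then have "A = A'" using *(2,4) by (subst (asm) (1 2) takeWhile_append2) auto
  ultimately have "A = A' \<and> B = B'" by simp
  with * show "p = q" by (simp add: p)
qed

text \<open>Splitting at the maximum gives Segner's recurrence: an upper set of size
  \<open>2 * i + 1\<close> leaves \<open>2 * (k - i) + 1\<close> letters, even sizes give nothing,
  and there is one upper set of each size.\<close>

lemma card_alt_perms132:
  "finite S \<Longrightarrow> card S = Suc (2 * n) \<Longrightarrow> card (alt_perms132 S) = catalan n"
proof (induction n arbitrary: S rule: less_induct)
  case (less n)
  show ?case
  proof (cases n)
    case 0
    then obtain x where "S = {x}" using less.prems card_1_singletonE by auto
    then show ?thesis using 0 by (simp add: alt_perms132_singleton)
  next
    case (Suc k)
    define m where "m = Max S"
    define T where "T = S - {m}"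
    have "S \<noteq> {}" using less.prems by auto
    then have "m \<in> S" using less.prems unfolding m_def by auto
    then have S: "S = insert m T" and T: "finite T" "card T = Suc (Suc (2 * k))"
      using less.prems Suc by (auto simp: T_def)
    have lt: "t < m" if "t \<in> T" for t
      using that less.prems unfolding T_def m_def by (simp add: order.strict_iff_order)
    have ne: "T \<noteq> {}" using T by auto
    let ?X = "SIGMA H:upper_sets T. alt_perms132 H \<times> alt_perms132 (T - H)"
    have card_part: "card (alt_perms132 H \<times> alt_perms132 (T - H)) =
        (if odd (card H) then catalan (card H div 2) * catalan (k - card H div 2) else 0)"
      if H: "H \<in> upper_sets T" for H
    proof (cases "odd (card H)")
      case True
      then obtain i where i: "card H = Suc (2 * i)" by (auto elim: oddE)
      have HT: "H \<subseteq> T" "finite H" using H T finite_subset by (auto simp: upper_sets_def)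
      then have le: "Suc (2 * i) \<le> Suc (Suc (2 * k))" using card_mono[OF T(1) HT(1)] i T by simp
      then have ik: "i \<le> k" by simp
      have "card (T - H) = Suc (2 * (k - i))"
        using HT T i ik by (simp add: card_Diff_subset)
      then have "card (alt_perms132 (T - H)) = catalan (k - i)"
        using less.IH[of "k - i" "T - H"] T Suc by simp
      moreover have "card (alt_perms132 H) = catalan i" using less.IH[of i H] i ik HT Suc by simp
      ultimately show ?thesis using True i by (simp add: card_cartesian_product)
    qed (simp add: alt_perms132_even_card_empty)
    have "alt_perms132 S = (\<lambda>(H, A, B). A @ m # B) ` ?X"
      unfolding S using ne lt by (rule alt_perms132_insert_max)
    moreover have "card \<dots> = card ?X"
    proof (rule card_image, rule inj_on_split_at)
      fix H A B assume "(H, A, B) \<in> ?X"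
      then show "set A = H \<and> m \<notin> H" using lt by (auto simp: alt_perms132_def upper_sets_def)
    qed
    ultimately have "card (alt_perms132 S) = card ?X" by simp
    also have "\<dots> = (\<Sum>H\<in>upper_sets T. card (alt_perms132 H \<times> alt_perms132 (T - H)))"
      using T finite_subset by (intro card_SigmaI finite_upper_sets)
        (auto simp: upper_sets_def intro!: finite_cartesian_product finite_alt_perms132)
    also have "\<dots> = (\<Sum>H\<in>upper_sets T.
        if odd (card H) then catalan (card H div 2) * catalan (k - card H div 2) else 0)"
      using card_part by (intro sum.cong) auto
    also have "\<dots> = (\<Sum>j\<le>card T. if odd j then catalan (j div 2) * catalan (k - j div 2) else 0)"
      by (rule sum.reindex_bij_betw[OF bij_betw_card_upper_sets[OF T(1)]])
    \<comment> \<open>Here \<open>card T\<close> is \<open>2 * Suc k\<close>, so the odd sizes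
      correspond to \<open>i < Suc k\<close>.\<close>
    also have "{..card T} = {..<Suc (2 * Suc k)}" using T by auto
    also have "(\<Sum>j\<in>\<dots>. if odd j then catalan (j div 2) * catalan (k - j div 2) else 0)
        = (\<Sum>i<Suc k. catalan i * catalan (k - i))"
      by (rule sum_odd_lessThan)
    finally show ?thesis using Suc by (simp add: lessThan_Suc_atMost)
  qed
qed

text \<open>The two families are \<open>m\<close> in a valley and \<open>m\<close> at a peak. In the
  second, the letters after \<open>n\<close> and then those between \<open>m\<close> and
  \<open>n\<close> are shown to lie below all of \<open>A\<close>; conversely an occurrence is
  located by whether its first letter lies in \<open>H\<close>.\<close>

lemma alt_perms_precede:
  assumes lt: "\<And>t. t \<in> T \<Longrightarrow> t < m" and mn: "m < n"
  shows "{xs \<in> alt_perms (insert m (insert n T)). subseq [m, n] xs} =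
    (\<lambda>R. m # n # R) ` alt_perms T \<union>
    (\<lambda>(H, A, P). A @ m # P) `
      (SIGMA H:upper_sets T - {T}. alt_perms132 H \<times> alt_perms (insert n (T - H)))"
    (is "?L = ?R1 \<union> ?R2")
proof (intro equalityI subsetI)
  have notin: "m \<notin> T" "n \<notin> T" using lt mn by (auto dest: less_trans)
  fix xs assume "xs \<in> ?L"
  then have xs: "distinct xs" "set xs = insert m (insert n T)" "odd (length xs)" "alternating xs"
    "avoids1342 xs" "avoids2431 xs" and mn_xs: "subseq [m, n] xs"
    by (auto simp: alt_perms_def)
  then obtain A P where AP: "xs = A @ m # P" by (metis insertI1 split_list)
  have dist: "distinct A" "distinct P" "set A \<inter> set P = {}" "m \<notin> set A" "m \<notin> set P"
    using xs(1) AP by auto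
  have nP: "n \<in> set P" using mn_xs dist(4) AP by (simp add: subseq_pair_after)
  have AT: "x \<in> T" if "x \<in> set A" for x
  proof -
    have "x \<in> set xs" "x \<noteq> m" "x \<noteq> n" using that AP dist nP by auto
    then show ?thesis using xs(2) by simp
  qed
  have sub: "subseq A xs" "subseq P xs" unfolding AP by auto
  show "xs \<in> ?R1 \<union> ?R2"
  proof (cases "even (length A)")
    case True
    have *: "A \<noteq> [] \<longrightarrow> m < last A" "P \<noteq> [] \<longrightarrow> m < hd P"
      using alternating_append_Cons_even[OF True] xs(4) AP by auto
    \<comment> \<open>In a valley \<open>m\<close> lies below its neighbours, and only
      \<open>n\<close> exceeds \<open>m\<close>. As \<open>n\<close> comes later, nothing precedes
      \<open>m\<close>, and \<open>n\<close> follows at once.\<close>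
    have "A = []"
    proof (rule ccontr)
      assume "A \<noteq> []"
      then show False using * lt[OF AT[of "last A"]] by simp
    qed
    have "P \<noteq> []" using nP by auto
    then have "hd P = n" using * xs(2) AP dist lt hd_in_set[of P] by fastforce
    then obtain R where P: "P = n # R" using \<open>P \<noteq> []\<close> by (cases P) auto
    have "set R = T" using xs(1,2) AP \<open>A = []\<close> P notin by auto
    then have "R \<in> alt_perms T"
      using xs sub(2) avoids1342_subseq[OF xs(5), of R] avoids2431_subseq[OF xs(6), of R]
      unfolding AP P \<open>A = []\<close> by (auto simp: alt_perms_def)
    then show ?thesis using AP P \<open>A = []\<close> by auto
  next
    case False
    have alt: "alternating A" "last A < m" "hd P < m" "alternating P"
      using alternating_append_Cons_odd[OF False] xs(4) AP nP by auto
    have oddP: "odd (length P)" using xs(3) AP False by auto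
    obtain B C where P: "P = B @ n # C" using nP by (meson split_list)
    have le_n: "x \<le> n" if "x \<in> set xs" for x using that xs(2) lt mn by fastforce
    \<comment> \<open>If \<open>n\<close> ended \<open>P\<close>, it would stand in a valley of
      \<open>P\<close>, hence be the only letter of \<open>P\<close>; but the letter after the peak
      \<open>m\<close> is below \<open>m\<close>.\<close>
    have "C \<noteq> []"
    proof
      assume "C = []"
      then have "even (length B)" using oddP P by simp
      then have "B \<noteq> [] \<longrightarrow> n < last B" using alternating_append_Cons_even alt(4) P by blast
      moreover have "last B \<le> n" if "B \<noteq> []" using that AP P by (intro le_n) simp
      ultimately have "B = []" by (meson not_le)
      then show False using alt(3) P mn by simp
    qed
    then obtain r where r: "r \<in> set C" by (cases C) auto
    have T: "T = set A \<union> set B \<union> set C" "set A \<inter> (set B \<union> set C) = {}" "n \<notin> set A"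
      using xs(1,2) AP P notin by auto
    \<comment> \<open>Otherwise \<open>a\<close>, \<open>m\<close>, \<open>n\<close>,
      \<open>c\<close> form a 1342.\<close>
    have gt_C: "c < a" if a: "a \<in> set A" and c: "c \<in> set C" for a c
    proof -
      have "subseq ([a] @ [m] @ [n] @ [c]) (A @ [m] @ (B @ [n]) @ C)"
        using a c by (intro list_emb_append_mono) (auto simp: subseq_singleton_left)
      then have "\<not> (a < c \<and> c < m \<and> m < n)"
        using xs(5) AP P unfolding avoids1342_def by simp
      moreover have "c < m" "a \<noteq> c" using lt T a c by auto
      ultimately show ?thesis using mn by auto
    qed
    \<comment> \<open>Otherwise \<open>a\<close>, \<open>m\<close>, \<open>c\<close>,
      \<open>r\<close> form a 2431, since \<open>r < a\<close> is known from
      \<open>gt_C\<close>.\<close>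
    have gt_B: "c < a" if a: "a \<in> set A" and c: "c \<in> set B" for a c
    proof -
      have "subseq ([a] @ [m] @ [c] @ [r]) (A @ [m] @ B @ (n # C))"
        using a c r by (intro list_emb_append_mono) (auto simp: subseq_singleton_left)
      then have "\<not> (r < a \<and> a < c \<and> c < m)"
        using xs(6) AP P unfolding avoids2431_def by simp
      moreover have "c < m" "a \<noteq> c" "r < a" using lt T a c r gt_C by auto
      ultimately show ?thesis using mn by auto
    qed
    have "set A \<in> upper_sets T" using gt_B gt_C T by (auto simp: upper_sets_def)
    moreover have "set A \<noteq> T" using r T by auto
    \<comment> \<open>A 132 in \<open>A\<close> followed by the smaller letter \<open>r\<close> is a
      2431.\<close>
    moreover have "avoids132 A"
      unfolding avoids132_def
    proof (intro allI impI notI)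
      fix a b c assume s: "subseq [a, b, c] A" and o: "a < c \<and> c < b"
      have "subseq ([a, b, c] @ [r]) (A @ (m # B @ n # C))"
        using s r by (intro list_emb_append_mono) (auto simp: subseq_singleton_left)
      moreover have "r < a" using subseq_set_mono[OF s] r gt_C by auto
      ultimately show False using xs(6) o AP P unfolding avoids2431_def by auto
    qed
    then have "A \<in> alt_perms132 (set A)" using dist alt False by (auto simp: alt_perms132_def)
    moreover have "set P = insert n (T - set A)" using T P by auto
    then have "P \<in> alt_perms (insert n (T - set A))"
      using dist alt oddP avoids1342_subseq[OF xs(5) sub(2)] avoids2431_subseq[OF xs(6) sub(2)]
      by (auto simp: alt_perms_def)
    ultimately have "(set A, A, P) \<in> (SIGMA H:upper_sets T - {T}. alt_perms132 H \<times> alt_perms (insert n (T - H)))"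
      by auto
    then show ?thesis using AP by force
  qed
next
  have notin: "m \<notin> T" "n \<notin> T" using lt mn by (auto dest: less_trans)
  fix xs assume "xs \<in> ?R1 \<union> ?R2"
  then show "xs \<in> ?L"
  proof
    assume "xs \<in> ?R1"
    then obtain R where R: "R \<in> alt_perms T" and xs: "xs = m # n # R" by auto
    have R': "distinct R" "set R = T" "odd (length R)" "alternating R" "avoids1342 R" "avoids2431 R"
      using R by (auto simp: alt_perms_def)
    have "R \<noteq> []" using R' by auto
    then have "hd R < n" using R'(2) lt[of "hd R"] mn hd_in_set[of R] by simp
    moreover have "avoids1342 xs"
      unfolding avoids1342_def
    proof (intro allI impI notI)
      fix a b c d assume s: "subseq [a, b, c, d] xs" and o: "a < d \<and> d < b \<and> b < c"
      have "set [a, b, c, d] \<subseteq> insert m (insert n T)" using subseq_set_mono[OF s] xs R' by simp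
      \<comment> \<open>The first letter has at least two larger letters in the occurrence, so it is
        neither \<open>m\<close> nor \<open>n\<close>, and the whole occurrence lies in
        \<open>R\<close>. The same argument serves for 2431.\<close>
      then have "a < m" "a < n" using lt[of a] lt[of d] lt[of b] o mn by auto
      then have "subseq [a, b, c, d] R" using s xs by (auto split: if_splits)
      then show False using R' o unfolding avoids1342_def by blast
    qed
    moreover have "avoids2431 xs"
      unfolding avoids2431_def
    proof (intro allI impI notI)
      fix a b c d assume s: "subseq [a, b, c, d] xs" and o: "d < a \<and> a < c \<and> c < b"
      have "set [a, b, c, d] \<subseteq> insert m (insert n T)" using subseq_set_mono[OF s] xs R' by simp
      then have "a < m" "a < n" using lt[of a] lt[of c] lt[of b] o mn by auto
      then have "subseq [a, b, c, d] R" using s xs by (auto split: if_splits)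
      then show False using R' o unfolding avoids2431_def by blast
    qed
    ultimately show ?thesis using R' notin mn xs by (auto simp: alt_perms_def)
  next
    assume "xs \<in> ?R2"
    then obtain H A P where H: "H \<in> upper_sets T" "H \<noteq> T" and A: "A \<in> alt_perms132 H"
      and P: "P \<in> alt_perms (insert n (T - H))" and xs: "xs = A @ m # P" by auto
    have A': "distinct A" "set A = H" "odd (length A)" "alternating A" "avoids132 A"
      using A by (auto simp: alt_perms132_def)
    have P': "distinct P" "set P = insert n (T - H)" "odd (length P)" "alternating P"
      "avoids1342 P" "avoids2431 P"
      using P by (auto simp: alt_perms_def)
    have HT: "H \<subseteq> T" "\<And>h l. h \<in> H \<Longrightarrow> l \<in> T - H \<Longrightarrow> l < h" using H by (auto simp: upper_sets_def)
    then obtain t where t: "t \<in> T - H" using H by auto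
    have ne: "A \<noteq> []" "P \<noteq> []" using A' P' by auto
    have "last A < m" using lt[of "last A"] A'(2) HT(1) last_in_set[OF ne(1)] by auto
    \<comment> \<open>By \<open>H \<noteq> T\<close> the word \<open>P\<close> has a letter besides
      \<open>n\<close>. It starts with an ascent, so it cannot start with its maximum
      \<open>n\<close>.\<close>
    moreover have "hd P < m"
    proof -
      obtain p Q where pQ: "P = p # Q" using ne by (cases P) auto
      have "p \<noteq> n"
      proof
        assume "p = n"
        have "t \<in> set Q" using t P'(2) pQ \<open>p = n\<close> notin by auto
        then obtain q Q' where "Q = q # Q'" by (cases Q) auto
        then have "n < q" "q \<in> T" using P' pQ \<open>p = n\<close> by auto
        then show False using lt[of q] mn by simp
      qed
      then show ?thesis using pQ P' lt by auto
    qed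
    ultimately have "alternating xs" using alternating_append_Cons_odd A' P' xs by simp
    moreover have set_xs: "set xs = insert m (insert n T)" using A' P' HT xs by auto
    moreover have "avoids1342 xs"
      unfolding avoids1342_def
    proof (intro allI impI notI)
      fix a b c d assume s: "subseq [a, b, c, d] xs" and o: "a < d \<and> d < b \<and> b < c"
      have "set [a, b, c, d] \<subseteq> insert m (insert n T)" using subseq_set_mono[OF s] set_xs by simp
      then have d: "d \<in> T" using lt[of b] lt[of c] o mn by auto
      then have a: "a < m" using lt[of d] o by simp
      \<comment> \<open>If \<open>a\<close> lies in \<open>H\<close>, the larger letter
        \<open>d\<close> does too, so the occurrence ends in \<open>A\<close>, and \<open>a\<close>,
        \<open>c\<close>, \<open>d\<close> form a 132 there. Otherwise it starts after
        \<open>A\<close>, and \<open>a < m\<close> places it in \<open>P\<close>.\<close>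
      show False
      proof (cases "a \<in> H")
        case True
        then have "d \<in> H" using HT(2)[of a d] d o by fastforce
        then have "d \<notin> set (m # P)" using P' HT notin by auto
        then have "subseq [a, b, c, d] A"
          using subseq4_append[OF s[unfolded xs]] by (auto dest!: subseq_set_mono split: if_splits)
        then have "subseq [a, c, d] A" by (auto intro: subseq_order.trans[rotated])
        then show False using A'(5) o unfolding avoids132_def by force
      next
        case False
        then have "subseq [a, b, c, d] (m # P)"
          using subseq4_append[OF s[unfolded xs]] A' by (auto dest!: subseq_set_mono)
        then have "subseq [a, b, c, d] P" using a by (auto split: if_splits)
        then show False using P'(5) o unfolding avoids1342_def by blast
      qed
    qed
    moreover have "avoids2431 xs"
      unfolding avoids2431_def
    proof (intro allI impI notI)
      fix a b c d assume s: "subseq [a, b, c, d] xs" and o: "d < a \<and> a < c \<and> c < b"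
      have "set [a, b, c, d] \<subseteq> insert m (insert n T)" using subseq_set_mono[OF s] set_xs by simp
      then have c: "c \<in> T \<or> c = m \<and> b = n" using lt[of b] lt[of c] o mn by auto
      have a: "a < m" using c lt[of c] o by auto
      show False
      proof (cases "a \<in> H")
        case True
        \<comment> \<open>In \<open>A @ m # P\<close> the letter \<open>n\<close> comes after
          \<open>m\<close>, so \<open>n\<close> followed by \<open>m\<close> cannot serve as the 4
          and the 3.\<close>
        have "\<not> (c = m \<and> b = n)"
        proof
          assume bc: "c = m \<and> b = n"
          then have "n \<notin> set A" "m \<notin> set A" "m \<notin> set P" using A' P' HT notin mn by auto
          then show False using subseq4_append[OF s[unfolded xs]] bc mn
            by (auto dest!: subseq_set_mono split: if_splits)
        qed
        then have "c \<in> H" using HT(2)[of a c] c o True by fastforce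
        then have "c \<notin> set (m # P)" using P' HT notin by auto
        \<comment> \<open>The last letter of the pattern may lie outside \<open>A\<close>, but the
          first three form a 132 whose last letter is in \<open>A\<close>.\<close>
        moreover have "subseq [a, b, c] (A @ m # P)"
          using s xs by (auto intro: subseq_order.trans[of _ "[a, b, c, d]"])
        ultimately have "subseq [a, b, c] A"
          using subseq3_append[of a b c A "m # P"] by (auto dest!: subseq_set_mono split: if_splits)
        then show False using A'(5) o unfolding avoids132_def by blast
      next
        case False
        then have "subseq [a, b, c, d] (m # P)"
          using subseq4_append[OF s[unfolded xs]] A' by (auto dest!: subseq_set_mono)
        then have "subseq [a, b, c, d] P" using a by (auto split: if_splits)
        then show False using P'(6) o unfolding avoids2431_def by blast
      qed
    qed
    moreover have "subseq [m, n] xs"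
    proof -
      have "subseq [m, n] (m # P)" using P' by (simp add: subseq_singleton_left)
      then show ?thesis unfolding xs by (rule subseq_drop_many)
    qed
    moreover have "distinct xs" "odd (length xs)" using A' P' HT notin mn xs by auto
    ultimately show ?thesis by (simp add: alt_perms_def)
  qed
qed

text \<open>Strong induction along \<open>alt_perms_precede\<close>. Reversal exchanges the words
  with \<open>m\<close> before \<open>n\<close> and those with \<open>n\<close> before
  \<open>m\<close>, which gives the factor 2.\<close>

lemma card_alt_perms:
  "finite S \<Longrightarrow> card S = Suc (2 * n) \<Longrightarrow> card (alt_perms S) = alt_count n"
proof (induction n arbitrary: S rule: less_induct)
  case (less N)
  show ?case
  proof (cases N)
    case 0
    then obtain x where "S = {x}" using less.prems card_1_singletonE by auto
    then show ?thesis using 0 by (simp add: alt_perms_singleton)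
  next
    case (Suc k)
    define n where "n = Max S"
    have "S \<noteq> {}" using less.prems by auto
    then have nS: "n \<in> S" and n_max: "\<And>x. x \<in> S \<Longrightarrow> x \<le> n"
      using less.prems unfolding n_def by auto
    define m where "m = Max (S - {n})"
    define T where "T = S - {n} - {m}"
    have card_Sn: "card (S - {n}) = Suc (Suc (2 * k))" using nS less.prems Suc by simp
    then have "S - {n} \<noteq> {}" by (metis card.empty nat.distinct(1))
    then have mS: "m \<in> S - {n}" and m_max: "\<And>x. x \<in> S - {n} \<Longrightarrow> x \<le> m"
      using less.prems unfolding m_def by (auto intro: Max_in simp del: Diff_iff)
    have S: "S = insert m (insert n T)" using nS mS by (auto simp: T_def)
    have T: "finite T" "card T = Suc (2 * k)"
      using less.prems card_Sn mS by (auto simp: T_def)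
    have lt: "t < m" if "t \<in> T" for t
      using m_max[of t] that by (auto simp: T_def order.strict_iff_order)
    have mn: "m < n" using n_max[of m] mS by auto
    have notin: "m \<notin> T" "n \<notin> T" by (auto simp: T_def)

    define X where "X = {xs \<in> alt_perms S. subseq [m, n] xs}"
    let ?f = "\<lambda>(H, A, P). A @ m # P"
    let ?Y = "SIGMA H:upper_sets T - {T}. alt_perms132 H \<times> alt_perms (insert n (T - H))"
    have X_eq: "X = (\<lambda>R. m # n # R) ` alt_perms T \<union> ?f ` ?Y"
      unfolding X_def S using lt mn by (rule alt_perms_precede)
    have finX: "finite X" using less.prems finite_alt_perms by (simp add: X_def)

    have card_part: "card (alt_perms132 H \<times> alt_perms (insert n (T - H))) =
        (if odd (card H) then catalan (card H div 2) * alt_count (k - card H div 2) else 0)"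
      if H: "H \<in> upper_sets T - {T}" for H
    proof (cases "odd (card H)")
      case True
      then obtain i where i: "card H = Suc (2 * i)" by (auto elim: oddE)
      have HT: "H \<subset> T" "finite H" using H T finite_subset by (auto simp: upper_sets_def)
      then have "Suc (2 * i) < Suc (2 * k)" using psubset_card_mono[OF T(1) HT(1)] i T by simp
      then have ik: "i < k" by simp
      have "card (T - H) = 2 * (k - i)"
        using HT T i ik by (simp add: card_Diff_subset psubset_imp_subset diff_mult_distrib2)
      \<comment> \<open>The block \<open>T - H\<close> has even size; \<open>n\<close> makes the
        size odd again.\<close>
      then have "card (insert n (T - H)) = Suc (2 * (k - i))" using T notin by simp
      then have "card (alt_perms (insert n (T - H))) = alt_count (k - i)"
        using less.IH[of "k - i" "insert n (T - H)"] T Suc by simp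
      moreover have "card (alt_perms132 H) = catalan i" using card_alt_perms132 HT i by simp
      ultimately show ?thesis using True i by (simp add: card_cartesian_product)
    qed (simp add: alt_perms132_even_card_empty)

    have "card (?f ` ?Y) = card ?Y"
    proof (rule card_image, rule inj_on_split_at)
      fix H A B assume "(H, A, B) \<in> ?Y"
      then show "set A = H \<and> m \<notin> H" using lt by (auto simp: alt_perms132_def upper_sets_def)
    qed
    also have "\<dots> = (\<Sum>H\<in>upper_sets T - {T}. card (alt_perms132 H \<times> alt_perms (insert n (T - H))))"
      using T finite_subset by (intro card_SigmaI finite_Diff finite_upper_sets)
        (auto simp: upper_sets_def intro!: finite_cartesian_product finite_alt_perms132 finite_alt_perms)
    also have "\<dots> = (\<Sum>H\<in>upper_sets T - {T}.
        if odd (card H) then catalan (card H div 2) * alt_count (k - card H div 2) else 0)"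
      using card_part by (intro sum.cong) auto
    also have "\<dots> = (\<Sum>j<card T. if odd j then catalan (j div 2) * alt_count (k - j div 2) else 0)"
      by (rule sum.reindex_bij_betw[OF bij_betw_card_proper_upper_sets[OF T(1)]])
    also have "\<dots> = (\<Sum>i<k. catalan i * alt_count (k - i))"
      unfolding T(2) by (rule sum_odd_lessThan)
    finally have card2: "card (?f ` ?Y) = (\<Sum>i<k. catalan i * alt_count (k - i))" .
    have card1: "card ((\<lambda>R. m # n # R) ` alt_perms T) = alt_count k"
      using less.IH[of k T] Suc T by (simp add: card_image inj_on_def)
    \<comment> \<open>Words of the first family start with \<open>m\<close>, those of the second
      with a letter of \<open>T\<close>.\<close>
    have disj: "(\<lambda>R. m # n # R) ` alt_perms T \<inter> ?f ` ?Y = {}"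
    proof -
      have "A \<noteq> [] \<and> hd A \<noteq> m" if "A \<in> alt_perms132 H" "H \<in> upper_sets T" for A H
      proof -
        have "A \<noteq> []" "set A \<subseteq> T" using that by (auto simp: alt_perms132_def upper_sets_def)
        then show ?thesis using notin hd_in_set by blast
      qed
      then show ?thesis by (fastforce simp: Cons_eq_append_conv)
    qed
    have cardX: "card X = alt_count k + (\<Sum>i<k. catalan i * alt_count (k - i))"
      using card_Un_disjoint[OF _ _ disj] finX card1 card2 unfolding X_eq by simp

    have rev_alt: "rev xs \<in> alt_perms S" if "xs \<in> alt_perms S" for xs
      using that by (simp add: alt_perms_def alternating_rev_odd avoids1342_rev avoids2431_rev)
    have rev_mem: "xs \<in> rev ` X \<longleftrightarrow> xs \<in> alt_perms S \<and> subseq [n, m] xs" for xs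
    proof
      assume "xs \<in> rev ` X"
      then show "xs \<in> alt_perms S \<and> subseq [n, m] xs"
        using rev_alt subseq_rev[of "[m, n]"] by (auto simp: X_def)
    next
      assume *: "xs \<in> alt_perms S \<and> subseq [n, m] xs"
      then have "rev xs \<in> X" using rev_alt[of xs] subseq_rev[of "[n, m]" xs] by (simp add: X_def)
      then show "xs \<in> rev ` X" by (metis imageI rev_rev_ident)
    qed
    have order: "subseq [n, m] xs \<longleftrightarrow> \<not> subseq [m, n] xs" if "xs \<in> alt_perms S" for xs
    proof -
      have xs: "distinct xs" "m \<in> set xs" "n \<in> set xs" using that S by (auto simp: alt_perms_def)
      then obtain A B where AB: "xs = A @ m # B" by (meson split_list)
      then have *: "m \<notin> set A" "m \<notin> set B" "n \<in> set A \<longleftrightarrow> n \<notin> set B" using xs mn by auto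
      have "subseq [m, n] xs \<longleftrightarrow> n \<in> set B" "subseq [n, m] xs \<longleftrightarrow> n \<in> set A"
        unfolding AB using * mn by (auto simp: subseq_pair_after subseq_pair_before)
      then show ?thesis using * by simp
    qed
    have "rev ` X = {xs \<in> alt_perms S. subseq [n, m] xs}" using rev_mem by blast
    then have "alt_perms S = X \<union> rev ` X" "X \<inter> rev ` X = {}"
      using order unfolding X_def by auto
    then have "card (alt_perms S) = card X + card (rev ` X)"
      using card_Un_disjoint finX by (metis finite_imageI)
    also have "card (rev ` X) = card X" by (intro card_image) simp
    finally show ?thesis using Suc cardX by simp
  qed
qed

lemma card_altAvoid: "card (altAvoid (2 * n + 1)) = alt_count n"
proof -
  have "length xs = 2 * n + 1" if "is_perm_of (2 * n + 1) xs" for xs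
    using that distinct_card[of xs] by (simp add: is_perm_of_def)
  then have "altAvoid (2 * n + 1) = alt_perms {1..2 * n + 1}"
    unfolding altAvoid_def alt_perms_def avoids_1342_iff avoids_2431_iff
    by (auto simp: is_perm_of_def)
  then show ?thesis using card_alt_perms[of "{1..2 * n + 1}" n] by simp
qed

subsection \<open>Generating functions\<close>

text \<open>The left side sums over the triangle \<open>i + j < n\<close>, the right side over the
  square containing it. This allows partial sums to be bounded by induction from the
  recurrences.\<close>

lemma sum_Cauchy_le:
  fixes a b :: "nat \<Rightarrow> real"
  assumes "\<And>n. 0 \<le> a n" "\<And>n. 0 \<le> b n"
  shows "(\<Sum>k<n. \<Sum>i\<le>k. a i * b (k - i)) \<le> (\<Sum>i<n. a i) * (\<Sum>i<n. b i)"
proof -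
  have "(\<Sum>k<n. \<Sum>i\<le>k. a i * b (k - i)) = (\<Sum>(i, j)\<in>{(i, j). i + j < n}. a i * b j)"
    by (simp add: sum.triangle_reindex)
  also have "\<dots> \<le> (\<Sum>(i, j)\<in>{..<n} \<times> {..<n}. a i * b j)"
    using assms by (intro sum_mono2) auto
  also have "\<dots> = (\<Sum>i<n. a i) * (\<Sum>i<n. b i)"
    by (simp add: sum_product sum.cartesian_product)
  finally show ?thesis .
qed

lemma catalan_term_Suc:
  "real (catalan (Suc n)) * x ^ Suc n = x * (\<Sum>i\<le>n. (real (catalan i) * x ^ i) * (real (catalan (n - i)) * x ^ (n - i)))"
proof -
  have "(real (catalan i) * x ^ i) * (real (catalan (n - i)) * x ^ (n - i)) = real (catalan i * catalan (n - i)) * x ^ n"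
    if "i \<le> n" for i
    using that by (simp flip: power_add)
  then have "(\<Sum>i\<le>n. (real (catalan i) * x ^ i) * (real (catalan (n - i)) * x ^ (n - i)))
      = (\<Sum>i\<le>n. real (catalan i * catalan (n - i)) * x ^ n)"
    by (intro sum.cong) auto
  also have "\<dots> = real (catalan (Suc n)) * x ^ n" by (simp add: sum_distrib_right)
  finally show ?thesis by simp
qed

text \<open>The sum is completed to a Cauchy product by the term \<open>i = n\<close>, which equals
  \<open>c n\<close> because \<open>alt_count 0 = 1\<close> and is subtracted again. This is the
  source of U - 1 in the functional equation.\<close>

lemma alt_count_term_Suc:
  fixes x :: real
  defines "c \<equiv> \<lambda>n. real (catalan n) * x ^ n" and "v \<equiv> \<lambda>n. real (alt_count n) * x ^ n"
  shows "v (Suc n) = 2 * x * (v n + (\<Sum>i\<le>n. c i * v (n - i)) - c n)"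
proof -
  have "c i * v (n - i) = real (catalan i * alt_count (n - i)) * x ^ n" if "i \<le> n" for i
    using that by (simp add: c_def v_def flip: power_add)
  then have "(\<Sum>i<n. c i * v (n - i)) = real (\<Sum>i<n. catalan i * alt_count (n - i)) * x ^ n"
    by (simp add: sum_distrib_right)
  moreover have "(\<Sum>i\<le>n. c i * v (n - i)) = (\<Sum>i<n. c i * v (n - i)) + c n"
    by (simp add: v_def flip: lessThan_Suc_atMost)
  ultimately show ?thesis by (simp add: v_def algebra_simps)
qed

lemma summable_of_sum_le:
  fixes a :: "nat \<Rightarrow> real"
  assumes "\<And>n. 0 \<le> a n" "0 < R" "\<And>N. (\<Sum>n<N. a n * R ^ n) \<le> B" "\<bar>x\<bar> \<le> R"
  shows "summable (\<lambda>n. norm (a n * x ^ n))"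
proof -
  have summ: "summable (\<lambda>n. a n * R ^ n)"
    using assms by (intro summableI_nonneg_bounded[where x = B]) auto
  have "norm (norm (a n * x ^ n)) \<le> a n * R ^ n" for n
    using assms by (auto simp: abs_mult power_abs intro!: mult_left_mono power_mono)
  then show ?thesis by (rule summable_comparison_test'[OF summ])
qed

text \<open>The bound reproduces itself: 2 is the double root of y = 1 + y * y / 4.\<close>

lemma sum_catalan_quarter_le: "(\<Sum>n<N. real (catalan n) * (1 / 4) ^ n) \<le> 2"
proof (induction N)
  case (Suc N)
  let ?c = "\<lambda>n. real (catalan n) * (1 / 4) ^ n"
  have "(\<Sum>n<Suc N. ?c n) = 1 + (\<Sum>n<N. ?c (Suc n))"
    by (subst sum.lessThan_Suc_shift) simp
  also have "\<dots> = 1 + 1 / 4 * (\<Sum>n<N. \<Sum>i\<le>n. ?c i * ?c (n - i))"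
    unfolding catalan_term_Suc by (simp only: sum_distrib_left)
  also have "\<dots> \<le> 1 + 1 / 4 * ((\<Sum>n<N. ?c n) * (\<Sum>n<N. ?c n))"
    using sum_Cauchy_le[of ?c ?c N] by simp
  also have "\<dots> \<le> 1 + 1 / 4 * (2 * 2)"
    using Suc by (intro add_left_mono mult_left_mono mult_mono) (auto intro: sum_nonneg)
  finally show ?case by simp
qed simp

lemma summable_catalan: "\<bar>x\<bar> \<le> 1 / 4 \<Longrightarrow> summable (\<lambda>n. norm (real (catalan n) * x ^ n))"
  using sum_catalan_quarter_le by (intro summable_of_sum_le[where R = "1 / 4" and B = 2]) auto

lemma catalan_gf:
  fixes x :: real
  assumes "\<bar>x\<bar> \<le> 1 / 4"
  shows "2 * x * (\<Sum>n. real (catalan n) * x ^ n) = 1 - sqrt (1 - 4 * x)"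
proof -
  let ?c = "\<lambda>n. real (catalan n) * x ^ n"
  define C where "C = (\<Sum>n. ?c n)"
  note sn = summable_catalan[OF assms]
  have "(\<lambda>n. ?c (Suc n)) sums (x * (C * C))"
    unfolding catalan_term_Suc C_def by (intro sums_mult Cauchy_product_sums sn)
  then have "?c sums (x * (C * C) + ?c 0)" by (rule sums_Suc)
  then have "C = x * (C * C) + ?c 0" using C_def sums_unique by metis
  then have "C = x * (C * C) + 1" by simp
  then have sq: "(1 - 2 * x * C)\<^sup>2 = 1 - 4 * x" by algebra
  \<comment> \<open>The square of \<open>1 - 2 * x * C\<close> is known. The bound 2 on
    \<open>\<bar>C\<bar>\<close> makes this quantity nonnegative and so selects the positive
    root.\<close>
  have "(\<Sum>n. real (catalan n) * (1 / 4) ^ n) \<le> 2"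
    using summable_catalan[of "1/4"] sum_catalan_quarter_le by (intro suminf_le_const) auto
  moreover have "\<bar>C\<bar> \<le> (\<Sum>n. real (catalan n) * (1 / 4) ^ n)"
  proof -
    have "norm C \<le> (\<Sum>n. norm (?c n))" unfolding C_def using sn by (rule summable_norm)
    also have "\<dots> \<le> (\<Sum>n. real (catalan n) * (1 / 4) ^ n)"
    proof (rule suminf_le[OF _ sn])
      show "summable (\<lambda>n. real (catalan n) * (1 / 4) ^ n)" using summable_catalan[of "1/4"] by simp
      show "norm (?c n) \<le> real (catalan n) * (1 / 4) ^ n" for n
        using assms power_mono[of "\<bar>x\<bar>" "1/4" n] by (simp add: abs_mult power_abs mult_left_mono)
    qed
    finally show ?thesis by simp
  qed
  ultimately have "\<bar>x\<bar> * \<bar>C\<bar> \<le> 1 / 4 * 2" using assms by (intro mult_mono) auto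
  then have "\<bar>x * C\<bar> \<le> 1 / 2" by (simp add: abs_mult)
  then have "0 \<le> 1 - 2 * x * C" by (simp add: abs_le_iff)
  then have "1 - 2 * x * C = sqrt (1 - 4 * x)" using sq by (metis real_sqrt_unique)
  then show ?thesis unfolding C_def by linarith
qed

text \<open>The radius 1/12 makes the bound 2 reproduce itself: with Catalan sums at most 2, the
  recurrence yields 1 + (2 + 2 * 2) / 6 = 2.\<close>

lemma sum_alt_count_twelfth_le: "(\<Sum>n<N. real (alt_count n) * (1 / 12) ^ n) \<le> 2"
proof (induction N)
  case (Suc N)
  let ?c = "\<lambda>n. real (catalan n) * (1 / 12) ^ n"
  let ?v = "\<lambda>n. real (alt_count n) * (1 / 12) ^ n"
  have c2: "(\<Sum>n<N. ?c n) \<le> 2"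
  proof -
    have "(\<Sum>n<N. ?c n) \<le> (\<Sum>n<N. real (catalan n) * (1 / 4) ^ n)"
      by (intro sum_mono mult_left_mono power_mono) auto
    then show ?thesis using sum_catalan_quarter_le[of N] by linarith
  qed
  have "(\<Sum>n<Suc N. ?v n) = 1 + (\<Sum>n<N. ?v (Suc n))"
    by (subst sum.lessThan_Suc_shift) simp
  \<comment> \<open>The subtracted Catalan term is dropped.\<close>
  also have "\<dots> \<le> 1 + (\<Sum>n<N. 1 / 6 * (?v n + (\<Sum>i\<le>n. ?c i * ?v (n - i))))"
    unfolding alt_count_term_Suc by (intro add_left_mono sum_mono) simp
  also have "\<dots> = 1 + 1 / 6 * ((\<Sum>n<N. ?v n) + (\<Sum>n<N. \<Sum>i\<le>n. ?c i * ?v (n - i)))"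
    by (simp only: sum_distrib_left[symmetric] sum.distrib)
  also have "\<dots> \<le> 1 + 1 / 6 * ((\<Sum>n<N. ?v n) + (\<Sum>n<N. ?c n) * (\<Sum>n<N. ?v n))"
    using sum_Cauchy_le[of ?c ?v N] by simp
  also have "\<dots> \<le> 1 + 1 / 6 * (2 + 2 * 2)"
    using Suc c2 by (intro add_left_mono add_mono mult_left_mono mult_mono) (auto intro: sum_nonneg)
  finally show ?case by simp
qed simp

lemma sqrt_one_minus_4x_gt:
  fixes x :: real
  assumes "\<bar>x\<bar> < 1 / 12"
  shows "1 / 2 < sqrt (1 - 4 * x)" "2 * x < sqrt (1 - 4 * x)"
proof -
  show "1 / 2 < sqrt (1 - 4 * x)"
    using assms by (intro real_less_rsqrt) (auto simp: power2_eq_square)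
  then show "2 * x < sqrt (1 - 4 * x)" using assms by linarith
qed

text \<open>Summing the recurrence gives V = 1 + 2 x (V + C V - C). Substituting 2 x C = 1 - s
  leaves the linear equation V (s - 2 x) = s.\<close>

lemma alt_count_gf:
  fixes x :: real
  assumes x: "\<bar>x\<bar> < 1 / 12"
  shows "(\<lambda>n. real (alt_count n) * x ^ n) sums (sqrt (1 - 4 * x) / (sqrt (1 - 4 * x) - 2 * x))"
proof -
  let ?c = "\<lambda>n. real (catalan n) * x ^ n" and ?v = "\<lambda>n. real (alt_count n) * x ^ n"
  define C where "C = (\<Sum>n. ?c n)"
  define V where "V = (\<Sum>n. ?v n)"
  define s where "s = sqrt (1 - 4 * x)"
  have sn: "summable (\<lambda>n. norm (?c n))" using x by (intro summable_catalan) auto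
  have vn: "summable (\<lambda>n. norm (?v n))"
    using x sum_alt_count_twelfth_le by (intro summable_of_sum_le[where R = "1 / 12" and B = 2]) auto
  have c: "?c sums C" and v: "?v sums V"
    unfolding C_def V_def
    by (rule summable_sums[OF summable_norm_cancel[OF sn]], rule summable_sums[OF summable_norm_cancel[OF vn]])
  have "(\<lambda>n. ?v (Suc n)) sums (2 * x * (V + C * V - C))"
    unfolding alt_count_term_Suc C_def V_def
    by (intro sums_mult sums_diff sums_add Cauchy_product_sums sn vn c[unfolded C_def] v[unfolded V_def])
  then have "?v sums (2 * x * (V + C * V - C) + ?v 0)" by (rule sums_Suc)
  then have V: "V = 1 + 2 * x * (V + C * V - C)" using v sums_unique2 by fastforce
  have "2 * x * C = 1 - s" unfolding C_def s_def using x by (intro catalan_gf) auto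
  then have "V * (s - 2 * x) = s" using V by algebra
  moreover have "s - 2 * x \<noteq> 0" unfolding s_def using sqrt_one_minus_4x_gt[OF x] by simp
  ultimately have "V = s / (s - 2 * x)" by (simp add: field_simps)
  then show ?thesis using v by (simp add: s_def)
qed

subsection \<open>Continued fraction\<close>

lemma cf_den_cong: "(\<And>i. j \<le> i \<Longrightarrow> a i = b i) \<Longrightarrow> cf_den a j k = cf_den b j k"
  by (induction k arbitrary: j) auto

text \<open>The limit t is the fixed point of d \<mapsto> 1 - x / d near 1. This map keeps values at
  least 1/2 and contracts the distance to t by a factor of at most 1/3.\<close>

lemma cf_den_const_tendsto:
  fixes x :: real
  assumes x: "\<bar>x\<bar> < 1 / 12"
  shows "cf_den (\<lambda>_. x) j \<longlonglongrightarrow> (1 + sqrt (1 - 4 * x)) / 2"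
proof -
  define s where "s = sqrt (1 - 4 * x)"
  define t where "t = (1 + s) / 2"
  have "1 / 2 < s" unfolding s_def by (rule sqrt_one_minus_4x_gt(1)[OF x])
  then have t: "1 / 2 \<le> t" by (simp add: t_def)
  have "s * s = 1 - 4 * x" using x by (simp add: s_def)
  then have "t * t = t - x" by (simp add: t_def field_simps)
  then have t_eq: "t = 1 - x / t" using t by (simp add: field_simps)
  have half: "1 / 2 \<le> cf_den (\<lambda>_. x) j k" for j k
  proof (induction k arbitrary: j)
    case (Suc k)
    have "\<bar>x / cf_den (\<lambda>_. x) (Suc j) k\<bar> \<le> (1 / 12) / (1 / 2)"
      unfolding abs_divide using Suc[of "Suc j"] x by (intro frac_le) auto
    also have "(1 / 12) / (1 / 2) \<le> (1 / 2 :: real)" by simp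
    finally have "x / cf_den (\<lambda>_. x) (Suc j) k \<le> 1 / 2" by (rule abs_le_D1)
    then show ?case unfolding cf_den.simps by linarith
  qed simp
  have bound: "\<bar>cf_den (\<lambda>_. x) j k - t\<bar> \<le> (1 / 3) ^ k * \<bar>1 - t\<bar>" for j k
  proof (induction k arbitrary: j)
    case (Suc k)
    define d where "d = cf_den (\<lambda>_. x) (Suc j) k"
    have d: "1 / 2 \<le> d" unfolding d_def by (rule half)
    have "cf_den (\<lambda>_. x) j (Suc k) - t = x / t - x / d" using t_eq by (simp add: d_def)
    \<comment> \<open>The contraction factor: \<open>t\<close> and \<open>d\<close> are at least
      1/2, so it is at most (1/12) / (1/4) = 1/3 in absolute value.\<close>
    also have "\<dots> = x / (t * d) * (d - t)" using t d by (simp add: field_simps)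
    finally have "\<bar>cf_den (\<lambda>_. x) j (Suc k) - t\<bar> = \<bar>x\<bar> / (t * d) * \<bar>d - t\<bar>"
      using t d by (simp add: abs_mult)
    also have "\<dots> \<le> (1 / 12) / (1 / 2 * (1 / 2)) * ((1 / 3) ^ k * \<bar>1 - t\<bar>)"
      using Suc[of "Suc j"] x t d unfolding d_def[symmetric]
      by (intro mult_mono frac_le) auto
    finally show ?case by simp
  qed simp
  have "(\<lambda>k. (1 / 3) ^ k * \<bar>1 - t\<bar>) \<longlonglongrightarrow> 0"
    by (intro tendsto_mult_left_zero LIMSEQ_power_zero) simp
  then have "(\<lambda>k. cf_den (\<lambda>_. x) j k - t) \<longlonglongrightarrow> 0"
    by (rule tendsto_0_le[where K = 1]) (use bound in \<open>auto simp: abs_mult\<close>)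
  then show ?thesis unfolding s_def[symmetric] t_def[symmetric] by (rule LIM_zero_cancel)
qed

text \<open>One level of the fraction is continuous in its tail away from 0, so limits can be
  computed from the inside out.\<close>

lemma cf_den_step_tendsto:
  assumes "cf_den a (Suc j) \<longlonglongrightarrow> L" "L \<noteq> 0"
  shows "cf_den a j \<longlonglongrightarrow> 1 - a j / L"
proof -
  have "(\<lambda>k. cf_den a j (Suc k)) \<longlonglongrightarrow> 1 - a j / L"
    using assms by (auto intro!: tendsto_intros)
  then show ?thesis by (rule LIMSEQ_imp_Suc)
qed

theorem theorem6p6:
  fixes u :: "nat \<Rightarrow> nat" and pn :: "real \<Rightarrow> nat \<Rightarrow> real"
  assumes u_def: "\<And>n. u n = card (altAvoid (2 * n + 1))"
    and pn_def: "\<And>x j. pn x j = (if j \<le> 2 then 2 * x else x)"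
  shows "\<exists>r>0. \<forall>x::real. \<bar>x\<bar> < r \<longrightarrow>
           (\<lambda>n. real (u n) * x ^ n) sums (sqrt (1 - 4 * x) / (sqrt (1 - 4 * x) - 2 * x))
         \<and> (\<lambda>k. 1 / cf_den (pn x) 1 k) \<longlonglongrightarrow> sqrt (1 - 4 * x) / (sqrt (1 - 4 * x) - 2 * x)"
proof (intro exI[of _ "1 / 12"] conjI allI impI)
  fix x :: real assume x: "\<bar>x\<bar> < 1 / 12"
  show "(\<lambda>n. real (u n) * x ^ n) sums (sqrt (1 - 4 * x) / (sqrt (1 - 4 * x) - 2 * x))"
    unfolding u_def card_altAvoid by (rule alt_count_gf[OF x])
  define s where "s = sqrt (1 - 4 * x)"
  have s: "1 / 2 < s" "2 * x < s" unfolding s_def by (rule sqrt_one_minus_4x_gt[OF x])+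
  have "s * s = 1 - 4 * x" unfolding s_def using x by simp
  \<comment> \<open>From index 3 on the numerators are constantly \<open>x\<close>; the two levels
    with \<open>2 * x\<close> are then put in front.\<close>
  have "cf_den (pn x) 3 = cf_den (\<lambda>_. x) 3"
    by (rule ext, rule cf_den_cong) (simp add: pn_def)
  then have "cf_den (pn x) (Suc 2) \<longlonglongrightarrow> (1 + s) / 2"
    using cf_den_const_tendsto[OF x, of 3] by (simp add: s_def)
  then have "cf_den (pn x) 2 \<longlonglongrightarrow> 1 - pn x 2 / ((1 + s) / 2)"
    using s by (intro cf_den_step_tendsto) auto
  \<comment> \<open>Here 4 x = 1 - s * s = (1 - s) (1 + s), so the level collapses to 1 - (1 -
    s).\<close>
  also have "1 - pn x 2 / ((1 + s) / 2) = s"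
    using s \<open>s * s = 1 - 4 * x\<close> by (simp add: pn_def field_simps)
  finally have "cf_den (pn x) (Suc 1) \<longlonglongrightarrow> s" by (simp add: numeral_2_eq_2)
  then have "cf_den (pn x) 1 \<longlonglongrightarrow> 1 - pn x 1 / s"
    using s by (intro cf_den_step_tendsto) auto
  then have "(\<lambda>k. 1 / cf_den (pn x) 1 k) \<longlonglongrightarrow> 1 / (1 - pn x 1 / s)"
    using s by (intro tendsto_intros) (auto simp: pn_def field_simps)
  also have "1 / (1 - pn x 1 / s) = s / (s - 2 * x)"
    using s by (simp add: pn_def field_simps)
  finally show "(\<lambda>k. 1 / cf_den (pn x) 1 k) \<longlonglongrightarrow> sqrt (1 - 4 * x) / (sqrt (1 - 4 * x) - 2 * x)"
    unfolding s_def .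
qed simp

end
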